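(* Let $\mathfrak g=\mathfrak{sl}_{r+1}(\mathbb C)$ with $r\ge 2$, and let $\lambda=\alpha_1+\alpha_2+\cdots+\alpha_r$ be the sum of its simple roots. Then $\sigma\in\mathcal A(\lambda,0)$ if and only if $\sigma=1$ or $\sigma=s_{i_1}s_{i_2}\cdots s_{i_k}$ for some collection of nonconsecutive integers $2\le i_1,i_2,\ldots,i_k\le r-1$.
   Context: The simple roots of $\mathfrak{sl}_{r+1}(\mathbb C)$ are $\Delta=\{\alpha_1,\ldots,\alpha_r\}$ and the positive roots are $\Phi^+=\{\alpha_i+\alpha_{i+1}+\cdots+\alpha_j:1\le i\le j\le r\}$. Set $\rho=\frac12\sum_{\alpha\in\Phi^+}\alpha$. The Weyl group $W$ is generated by the simple reflections $s_1,\ldots,s_r$, where $s_i(\alpha_i)=-\alpha_i$, $s_i(\alpha_j)=\alpha_i+\alpha_j$ if $|i-j|=1$, and $s_i(\alpha_j)=\alpha_j$ if $|i-j|>1$. Kostant's partition function $\wp(\xi)$ is the number of ways to write $\xi$ as a nonnegative integral linear combination of positive roots (so $\wp(0)=1$). For weights $\lambda,\mu$, the Weyl alternation set is $\mathcal A(\lambda,\mu)=\{\sigma\in W:\wp(\sigma(\lambda+\rho)-(\mu+\rho))>0\}$. Integers $i_1,\ldots,i_k$ are nonconsecutive if $|i_a-i_b|\ge 2$ for all $a\ne b$. *)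

theory Defs
  imports "HOL-Algebra.Algebra" "HOL-Library.Function_Algebras"
begin

text \<open>
  A weight of type \<open>A\<close>, rank \<open>r\<close>, is given by its coordinates with respect to the basis of
  simple roots indexed by \<open>1, \<dots>, r\<close>. Addition, subtraction, sums and zero of weights are
  the pointwise operations of Function_Algebras.
\<close>

type_synonym weight = "nat \<Rightarrow> real"

definition weight_space :: "nat \<Rightarrow> weight set" where
  "weight_space r = {v. \<forall>j. j \<notin> {1..r} \<longrightarrow> v j = 0}"

definition scale_weight :: "real \<Rightarrow> weight \<Rightarrow> weight" where
  "scale_weight c v = (\<lambda>j. c * v j)"

definition simple_root :: "nat \<Rightarrow> weight" where
  "simple_root i = (\<lambda>j. if j = i then 1 else 0)"

definition positive_roots :: "nat \<Rightarrow> weight set" where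
  "positive_roots r = {\<Sum>k=i..j. simple_root k | i j. 1 \<le> i \<and> i \<le> j \<and> j \<le> r}"

definition rho :: "nat \<Rightarrow> weight" where
  "rho r = scale_weight (1/2) (\<Sum>\<beta>\<in>positive_roots r. \<beta>)"

definition reflect_simple_root :: "nat \<Rightarrow> nat \<Rightarrow> weight" where
  "reflect_simple_root i j =
    (if i = j then - simple_root i
     else if \<bar>int i - int j\<bar> = 1 then simple_root i + simple_root j
     else simple_root j)"

text \<open>
  The linear extension of \<^const>\<open>reflect_simple_root\<close> to the weight space; it is restricted to
  that space because the elements of \<^const>\<open>BijGroup\<close> are extensional functions.
\<close>

definition simple_reflection :: "nat \<Rightarrow> nat \<Rightarrow> weight \<Rightarrow> weight" where
  "simple_reflection r i =
    (\<lambda>v\<in>weight_space r. \<Sum>j=1..r. scale_weight (v j) (reflect_simple_root i j))"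

definition weyl_group :: "nat \<Rightarrow> (weight \<Rightarrow> weight) monoid" where
  "weyl_group r =
    subgroup_generated (BijGroup (weight_space r)) (simple_reflection r ` {1..r})"

text \<open>
  A way to write \<open>\<xi>\<close> as a nonnegative integral combination of positive roots is its family of
  multiplicities, taken extensional so that distinct functions are distinct combinations.
\<close>

definition kostant_partition :: "nat \<Rightarrow> weight \<Rightarrow> nat" where
  "kostant_partition r \<xi> =
    card {m \<in> positive_roots r \<rightarrow>\<^sub>E (UNIV :: nat set).
            (\<Sum>\<beta>\<in>positive_roots r. scale_weight (real (m \<beta>)) \<beta>) = \<xi>}"

definition weyl_alternation_set :: "nat \<Rightarrow> weight \<Rightarrow> weight \<Rightarrow> (weight \<Rightarrow> weight) set" where
  "weyl_alternation_set r lam mu =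
    {\<sigma> \<in> carrier (weyl_group r). kostant_partition r (\<sigma> (lam + rho r) - (mu + rho r)) > 0}"

definition nonconsecutive :: "nat list \<Rightarrow> bool" where
  "nonconsecutive xs \<longleftrightarrow>
    (\<forall>a<length xs. \<forall>b<length xs. a \<noteq> b \<longrightarrow> \<bar>int (xs ! a) - int (xs ! b)\<bar> \<ge> 2)"

text \<open>The product \<open>s\<^sub>i\<^sub>1 \<cdots> s\<^sub>i\<^sub>k\<close> in the Weyl group, for the list of indices \<open>i\<^sub>1, \<dots>, i\<^sub>k\<close>.\<close>

definition reflection_product :: "nat \<Rightarrow> nat list \<Rightarrow> weight \<Rightarrow> weight" where
  "reflection_product r xs =
    foldr (\<lambda>i \<sigma>. simple_reflection r i \<otimes>\<^bsub>weyl_group r\<^esub> \<sigma>) xs \<one>\<^bsub>weyl_group r\<^esub>"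

end

theory Submission
  imports Defs
begin

text \<open>
  Write a weight \<open>v\<close> in the differences \<open>e\<^sub>k(v) = v\<^sub>k - v\<^sub>k\<^sub>-\<^sub>1\<close> for \<open>1 \<le> k \<le> r + 1\<close>, where
  \<open>v\<^sub>0 = v\<^sub>r\<^sub>+\<^sub>1 = 0\<close>; these are the coordinates in the standard realisation of \<open>A\<^sub>r\<close> inside
  \<open>\<real>\<^sup>r\<^sup>+\<^sup>1\<close>, and the Weyl group acts on them by permutations
  (\<open>weyl_group_permutes_eps_coord\<close>). Since the simple roots are positive roots,
  \<open>\<wp>(\<xi>) > 0\<close> means that all coordinates of \<open>\<xi>\<close> are natural numbers
  (\<open>kostant_partition_pos_iff\<close>). Put \<open>u = \<lambda> + \<rho>\<close> and \<open>x = \<sigma>(u) - \<rho>\<close>.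

  If \<open>\<sigma>\<close> is a product of pairwise commuting reflections \<open>s\<^sub>i\<close> with \<open>2 \<le> i \<le> r - 1\<close>, then each
  factor subtracts its own simple root from \<open>u\<close>, so that \<open>x\<close> is \<open>\<lambda>\<close> minus a sum of distinct simple
  roots, and its coordinates are \<open>0\<close> and \<open>1\<close>.

  Conversely suppose that the coordinates of \<open>x\<close> are natural numbers. The differences of \<open>u\<close>
  strictly decrease, so permuting them cannot increase any initial sum
  (\<open>weyl_group_root_plus_rho_le\<close>); hence \<open>x \<le> \<lambda>\<close>, and every coordinate of \<open>x\<close> is \<open>0\<close> or \<open>1\<close>. The heart
  of the matter is that \<open>x\<close> never vanishes at two adjacent places of \<open>0, \<dots>, r + 1\<close>
  (\<open>no_adjacent_zeros\<close>), because this would make two differences of \<open>\<sigma>(u)\<close> equal, or force the value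
  \<open>r/2\<close>, which is not among the differences of \<open>u\<close>. As \<open>x\<close> vanishes at \<open>0\<close> and at \<open>r + 1\<close>, the set \<open>I\<close> of
  its zeros in \<open>{1..r}\<close> lies in \<open>{2..r - 1}\<close> and has no two consecutive members. The product of the \<open>s\<^sub>i\<close> with \<open>i \<in> I\<close>
  sends \<open>u\<close> to the same weight as \<open>\<sigma>\<close>, and the two agree because the differences
  of \<open>u\<close> are distinct, so that \<open>u\<close> has trivial stabiliser (\<open>weyl_group_eq_if_regular\<close>).
\<close>

section \<open>Roots, the half-sum of positive roots, and partitions\<close>

lemma sum_fun_apply: "(\<Sum>x\<in>A. f x) j = (\<Sum>x\<in>A. f x j)"
  by (induction A rule: infinite_finite_induct) auto

lemma interval_root_apply:
  "(\<Sum>k=i..j. simple_root k) l = (if i \<le> l \<and> l \<le> j then 1 else 0)"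
  by (simp add: sum_fun_apply simple_root_def)

lemma positive_roots_image:
  "positive_roots r =
    (\<lambda>(i, j). \<Sum>k=i..j. simple_root k) ` {(i, j). 1 \<le> i \<and> i \<le> j \<and> j \<le> r}"
  by (auto simp: positive_roots_def)

lemma finite_interval_pairs: "finite {(i, j). 1 \<le> i \<and> i \<le> j \<and> j \<le> (r::nat)}"
  by (rule finite_subset[of _ "{1..r} \<times> {1..r}"]) auto

lemma finite_positive_roots: "finite (positive_roots r)"
  unfolding positive_roots_image using finite_interval_pairs by blast

lemma simple_root_positive: "1 \<le> i \<Longrightarrow> i \<le> r \<Longrightarrow> simple_root i \<in> positive_roots r"
  unfolding positive_roots_def by (intro CollectI exI[of _ i]) auto

lemma inj_on_interval_roots:
  "inj_on (\<lambda>(i, j). \<Sum>k=i..j. simple_root k) {(i, j). 1 \<le> i \<and> i \<le> j \<and> j \<le> r}"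
proof (rule inj_onI, clarify)
  fix i j i' j' :: nat
  assume le: "i \<le> j" "i' \<le> j'"
    and eq: "(\<Sum>k=i..j. simple_root k) = (\<Sum>k=i'..j'. simple_root k)"
  have mem: "i \<le> l \<and> l \<le> j \<longleftrightarrow> i' \<le> l \<and> l \<le> j'" for l
    using fun_cong[OF eq, of l]
    by (cases "i \<le> l \<and> l \<le> j"; cases "i' \<le> l \<and> l \<le> j'")
       (simp_all only: interval_root_apply, simp_all)
  show "i = i' \<and> j = j'"
    using mem[of i] mem[of i'] mem[of j] mem[of j'] le by linarith
qed

text \<open>
  The \<open>j\<close>-th coordinate of the sum of all positive roots counts the intervals in \<open>{1..r}\<close> that
  contain \<open>j\<close>: there are \<open>j\<close> choices for the left end and \<open>r + 1 - j\<close> for the right end.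
\<close>

lemma rho_apply: "rho r j = real j * (real r + 1 - real j) / 2" if "j \<le> r + 1"
proof -
  let ?P = "{(i, k). 1 \<le> i \<and> i \<le> k \<and> k \<le> r}"
  have "(\<Sum>\<beta>\<in>positive_roots r. \<beta>) j = (\<Sum>\<beta>\<in>positive_roots r. \<beta> j)"
    by (rule sum_fun_apply)
  also have "\<dots> = (\<Sum>(i, k)\<in>?P. (\<Sum>l=i..k. simple_root l) j)"
    unfolding positive_roots_image
    by (subst sum.reindex[OF inj_on_interval_roots]) (simp add: case_prod_unfold)
  also have "\<dots> = (\<Sum>p\<in>?P. if p \<in> {1..j} \<times> {j..r} then 1 else 0)"
    by (rule sum.cong) (simp_all add: case_prod_unfold interval_root_apply mem_Times_iff)
  also have "\<dots> = real (card (?P \<inter> ({1..j} \<times> {j..r})))"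
    unfolding sum.inter_restrict[OF finite_interval_pairs, symmetric] by simp
  also have "?P \<inter> ({1..j} \<times> {j..r}) = {1..j} \<times> {j..r}"
    by auto
  also have "real (card ({1..j} \<times> {j..r})) = real j * (real r + 1 - real j)"
    using that by (simp add: card_cartesian_product of_nat_diff)
  finally show ?thesis
    by (simp add: rho_def scale_weight_def)
qed

lemma rho_in_weight_space: "rho r \<in> weight_space r"
proof -
  have "\<beta> j = 0" if "\<beta> \<in> positive_roots r" "j \<notin> {1..r}" for \<beta> j
    using that by (auto simp: positive_roots_def interval_root_apply)
  then show ?thesis
    by (auto simp: weight_space_def rho_def scale_weight_def sum_fun_apply intro!: sum.neutral)
qed

lemma Nats_sum:
  fixes f :: "'a \<Rightarrow> 'b::semiring_1"
  assumes "\<And>x. x \<in> A \<Longrightarrow> f x \<in> \<nat>"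
  shows "sum f A \<in> \<nat>"
  using assms by (induction A rule: infinite_finite_induct) auto

text \<open>
  As a cardinality, the partition function would be \<open>0\<close> also on an infinite set of combinations.
  That set is finite: a root with left end \<open>i\<close> contributes its multiplicity to the coordinate \<open>\<xi>\<^sub>i\<close>,
  so every multiplicity is bounded by the sum of the coordinates of \<open>\<xi>\<close>.
\<close>

lemma kostant_partition_pos_iff:
  assumes "\<xi> \<in> weight_space r"
  shows "kostant_partition r \<xi> > 0 \<longleftrightarrow> (\<forall>j. \<xi> j \<in> \<nat>)"
proof -
  let ?M = "{m \<in> positive_roots r \<rightarrow>\<^sub>E (UNIV :: nat set).
      (\<Sum>\<beta>\<in>positive_roots r. scale_weight (real (m \<beta>)) \<beta>) = \<xi>}"
  have root01: "\<beta> j \<in> {0, 1}" if "\<beta> \<in> positive_roots r" for \<beta> j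
    using that by (auto simp: positive_roots_def interval_root_apply)
  have coord: "\<xi> j = (\<Sum>\<beta>\<in>positive_roots r. real (m \<beta>) * \<beta> j)" if "m \<in> ?M" for m j
  proof -
    have "\<xi> = (\<Sum>\<beta>\<in>positive_roots r. scale_weight (real (m \<beta>)) \<beta>)"
      using that by simp
    then show ?thesis
      by (simp only: sum_fun_apply scale_weight_def)
  qed
  have nonneg: "0 \<le> real (m \<beta>) * \<beta> j" if "\<beta> \<in> positive_roots r" for m :: "weight \<Rightarrow> nat" and \<beta> j
    using root01[OF that, of j] by auto
  have fin: "finite ?M"
  proof (rule finite_subset)
    let ?B = "{n. real n \<le> (\<Sum>j=1..r. \<xi> j)}"
    show "?M \<subseteq> positive_roots r \<rightarrow>\<^sub>E ?B"
    proof
      fix m assume m: "m \<in> ?M"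
      have "real (m \<beta>) \<le> (\<Sum>j=1..r. \<xi> j)" if \<beta>: "\<beta> \<in> positive_roots r" for \<beta>
      proof -
        obtain i k where ik: "1 \<le> i" "i \<le> k" "k \<le> r" and b: "\<beta> = (\<Sum>l=i..k. simple_root l)"
          using \<beta> by (auto simp: positive_roots_def)
        have "real (m \<beta>) = real (m \<beta>) * \<beta> i"
          using ik by (simp add: b interval_root_apply)
        also have "\<dots> \<le> (\<Sum>\<beta>\<in>positive_roots r. real (m \<beta>) * \<beta> i)"
          by (rule member_le_sum[OF \<beta> _ finite_positive_roots]) (use nonneg in auto)
        also have "\<dots> = \<xi> i"
          using coord[OF m] by simp
        also have "\<dots> \<le> (\<Sum>j=1..r. \<xi> j)"
          by (rule member_le_sum) (use ik coord[OF m] nonneg in \<open>auto intro: sum_nonneg\<close>)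
        finally show ?thesis .
      qed
      with m show "m \<in> positive_roots r \<rightarrow>\<^sub>E ?B"
        by (auto simp: PiE_iff)
    qed
    have "?B \<subseteq> {..nat \<lfloor>\<Sum>j=1..r. \<xi> j\<rfloor>}"
      by (auto simp: le_nat_floor)
    then show "finite (positive_roots r \<rightarrow>\<^sub>E ?B)"
      by (intro finite_PiE finite_positive_roots) (auto intro: finite_subset)
  qed
  have "?M \<noteq> {} \<longleftrightarrow> (\<forall>j. \<xi> j \<in> \<nat>)"
  proof
    assume "?M \<noteq> {}"
    then obtain m where m: "m \<in> ?M"
      by blast
    show "\<forall>j. \<xi> j \<in> \<nat>"
    proof
      fix j
      have "real (m \<beta>) * \<beta> j \<in> \<nat>" if "\<beta> \<in> positive_roots r" for \<beta>
        using root01[OF that, of j] by auto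
      then show "\<xi> j \<in> \<nat>"
        unfolding coord[OF m, of j] by (rule Nats_sum)
    qed
  next
    assume nat: "\<forall>j. \<xi> j \<in> \<nat>"
    \<comment> \<open>Using simple roots only, the multiplicities are the coordinates themselves.\<close>
    define m where "m = (\<lambda>\<beta>\<in>positive_roots r.
      \<Sum>i=1..r. if \<beta> = simple_root i then nat \<lfloor>\<xi> i\<rfloor> else 0)"
    have "(\<Sum>\<beta>\<in>positive_roots r. real (m \<beta>) * \<beta> j) = \<xi> j" for j
    proof -
      have "(\<Sum>\<beta>\<in>positive_roots r. real (m \<beta>) * \<beta> j) =
          (\<Sum>\<beta>\<in>positive_roots r. \<Sum>i=1..r.
            if \<beta> = simple_root i then real (nat \<lfloor>\<xi> i\<rfloor>) * simple_root i j else 0)"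
        by (rule sum.cong) (auto simp: m_def sum_distrib_right intro!: sum.cong)
      also have "\<dots> = (\<Sum>i=1..r. \<Sum>\<beta>\<in>positive_roots r.
            if \<beta> = simple_root i then real (nat \<lfloor>\<xi> i\<rfloor>) * simple_root i j else 0)"
        by (rule sum.swap)
      also have "\<dots> = (\<Sum>i=1..r. real (nat \<lfloor>\<xi> i\<rfloor>) * simple_root i j)"
        by (rule sum.cong)
          (auto simp: sum.delta[OF finite_positive_roots] simple_root_positive)
      also have "\<dots> = (\<Sum>i=1..r. if i = j then real (nat \<lfloor>\<xi> j\<rfloor>) else 0)"
        by (rule sum.cong) (auto simp: simple_root_def)
      also have "\<dots> = (if j \<in> {1..r} then real (nat \<lfloor>\<xi> j\<rfloor>) else 0)"
        by simp
      also have "\<dots> = \<xi> j"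
      proof (cases "j \<in> {1..r}")
        case True
        obtain n where "\<xi> j = of_nat n"
          using nat by (auto elim: Nats_cases)
        with True show ?thesis
          by simp
      next
        case False
        with assms show ?thesis
          by (auto simp: weight_space_def)
      qed
      finally show ?thesis .
    qed
    then have "m \<in> ?M"
      by (auto simp: m_def scale_weight_def sum_fun_apply fun_eq_iff)
    then show "?M \<noteq> {}"
      by blast
  qed
  then show ?thesis
    using fin by (simp add: kostant_partition_def card_gt_0_iff)
qed

section \<open>The Weyl group as permutations of coordinates\<close>

text \<open>
  With \<open>\<alpha>\<^sub>i = \<epsilon>\<^sub>i - \<epsilon>\<^sub>i\<^sub>+\<^sub>1\<close>, this is the coefficient of \<open>\<epsilon>\<^sub>k\<close> for \<open>1 \<le> k \<le> r + 1\<close>. At \<open>k = 0\<close> truncated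
  subtraction makes it \<open>0\<close>, which lets later identities hold for all \<open>k\<close>.
\<close>

definition eps_coord :: "weight \<Rightarrow> nat \<Rightarrow> real" where
  "eps_coord v k = v k - v (k - 1)"

lemma sum_eps_coord: "v 0 = 0 \<Longrightarrow> (\<Sum>k=1..j. eps_coord v k) = v j"
  by (induction j) (auto simp: eps_coord_def)

lemma weight_eqI:
  assumes "v \<in> weight_space r" "w \<in> weight_space r" "\<And>k. eps_coord v k = eps_coord w k"
  shows "v = w"
proof
  fix j
  have "v 0 = 0" "w 0 = 0"
    using assms by (auto simp: weight_space_def)
  then show "v j = w j"
    using sum_eps_coord[of v j] sum_eps_coord[of w j] assms(3) by simp
qed

lemma simple_reflection_apply:
  assumes v: "v \<in> weight_space r" and i: "i \<in> {1..r}"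
  shows "simple_reflection r i v = v(i := v (i - 1) + v (i + 1) - v i)"
proof
  fix l
  have "simple_reflection r i v l = (\<Sum>j=1..r. v j * reflect_simple_root i j l)"
    using v by (simp add: simple_reflection_def sum_fun_apply scale_weight_def)
  \<comment> \<open>When \<open>i\<close> is \<open>1\<close> or \<open>r\<close>, the summand for a neighbour outside \<open>{1..r}\<close> drops out, and \<open>v 0\<close> or
    \<open>v (r + 1)\<close> is \<open>0\<close> accordingly.\<close>
  also have "\<dots> = (\<Sum>j=1..r. (if j = l then (if l = i then - v l else v l) else 0)
      + (if j = i - 1 then (if l = i then v (i - 1) else 0) else 0)
      + (if j = i + 1 then (if l = i then v (i + 1) else 0) else 0))"
    by (rule sum.cong) (use i in \<open>auto simp: reflect_simple_root_def simple_root_def\<close>)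
  also have "\<dots> = (v(i := v (i - 1) + v (i + 1) - v i)) l"
    using v i by (auto simp: sum.distrib weight_space_def)
  finally show "simple_reflection r i v l = (v(i := v (i - 1) + v (i + 1) - v i)) l" .
qed

lemma simple_reflection_closed:
  "v \<in> weight_space r \<Longrightarrow> i \<in> {1..r} \<Longrightarrow> simple_reflection r i v \<in> weight_space r"
  by (auto simp: simple_reflection_apply weight_space_def)

text \<open>
  Replacing \<open>v\<^sub>i\<close> by \<open>v\<^sub>i\<^sub>-\<^sub>1 + v\<^sub>i\<^sub>+\<^sub>1 - v\<^sub>i\<close> exchanges the two differences in which \<open>v\<^sub>i\<close> occurs.
\<close>

lemma eps_coord_simple_reflection:
  assumes "v \<in> weight_space r" "i \<in> {1..r}"
  shows "eps_coord (simple_reflection r i v) k = eps_coord v (transpose i (i + 1) k)"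
  using assms unfolding simple_reflection_apply[OF assms]
  by (cases "k = i"; cases "k = i + 1"; cases "k = 0")
     (auto simp: eps_coord_def transpose_def)

lemma simple_reflection_involution:
  assumes "v \<in> weight_space r" "i \<in> {1..r}"
  shows "simple_reflection r i (simple_reflection r i v) = v"
  by (rule weight_eqI[of _ r])
     (use assms in \<open>auto simp: simple_reflection_closed eps_coord_simple_reflection\<close>)

lemma simple_reflection_in_Bij:
  assumes "i \<in> {1..r}"
  shows "simple_reflection r i \<in> Bij (weight_space r)"
proof -
  have "bij_betw (simple_reflection r i) (weight_space r) (weight_space r)"
    by (rule bij_betw_byWitness[where f' = "simple_reflection r i"])
       (use assms in \<open>auto simp: simple_reflection_involution simple_reflection_closed\<close>)
  then show ?thesis
    by (simp add: Bij_def simple_reflection_def)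
qed

lemma inv_simple_reflection:
  assumes "i \<in> {1..r}"
  shows "inv\<^bsub>BijGroup (weight_space r)\<^esub> (simple_reflection r i) = simple_reflection r i"
proof (rule group.inv_equality[OF group_BijGroup])
  show "simple_reflection r i \<otimes>\<^bsub>BijGroup (weight_space r)\<^esub> simple_reflection r i
      = \<one>\<^bsub>BijGroup (weight_space r)\<^esub>"
    using assms simple_reflection_in_Bij[OF assms]
    by (auto simp: BijGroup_def compose_def simple_reflection_involution intro!: restrict_ext)
qed (use simple_reflection_in_Bij[OF assms] in \<open>auto simp: BijGroup_def\<close>)

lemma group_weyl_group: "group (weyl_group r)"
  unfolding weyl_group_def by (rule group.group_subgroup_generated[OF group_BijGroup])

lemma weyl_group_in_Bij: "\<sigma> \<in> carrier (weyl_group r) \<Longrightarrow> \<sigma> \<in> Bij (weight_space r)"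
  using group.carrier_subgroup_generated_subset[OF group_BijGroup]
  by (fastforce simp: weyl_group_def BijGroup_def)

lemma weyl_group_closed:
  "\<sigma> \<in> carrier (weyl_group r) \<Longrightarrow> v \<in> weight_space r \<Longrightarrow> \<sigma> v \<in> weight_space r"
  using weyl_group_in_Bij Bij_imp_funcset by blast

lemma one_weyl_group_apply: "v \<in> weight_space r \<Longrightarrow> \<one>\<^bsub>weyl_group r\<^esub> v = v"
  by (simp add: weyl_group_def BijGroup_def)

lemma mult_weyl_group_apply:
  assumes "\<sigma> \<in> carrier (weyl_group r)" "\<tau> \<in> carrier (weyl_group r)" "v \<in> weight_space r"
  shows "(\<sigma> \<otimes>\<^bsub>weyl_group r\<^esub> \<tau>) v = \<sigma> (\<tau> v)"
  using assms weyl_group_in_Bij[OF assms(1)] weyl_group_in_Bij[OF assms(2)]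
  by (simp add: weyl_group_def BijGroup_def compose_def)

lemma simple_reflection_in_weyl_group:
  assumes "i \<in> {1..r}"
  shows "simple_reflection r i \<in> carrier (weyl_group r)"
  using assms simple_reflection_in_Bij[OF assms]
  by (auto simp: weyl_group_def carrier_subgroup_generated BijGroup_def intro!: generate.incl)

lemma weyl_group_permutes_eps_coord:
  assumes "\<sigma> \<in> carrier (weyl_group r)"
  obtains p where "p permutes {1..r + 1}"
    and "\<And>v k. v \<in> weight_space r \<Longrightarrow> eps_coord (\<sigma> v) k = eps_coord v (p k)"
proof -
  let ?G = "BijGroup (weight_space r)"
  let ?P = "\<lambda>\<sigma>. \<exists>p. p permutes {1..r + 1} \<and>
    (\<forall>v\<in>weight_space r. \<forall>k. eps_coord (\<sigma> v) k = eps_coord v (p k))"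
  have swap: "?P (simple_reflection r i)" if "i \<in> {1..r}" for i
    by (intro exI[of _ "transpose i (i + 1)"] conjI permutes_swap_id)
       (use that in \<open>auto simp: eps_coord_simple_reflection\<close>)
  have "\<sigma> \<in> generate ?G (carrier ?G \<inter> simple_reflection r ` {1..r})"
    using assms by (simp add: weyl_group_def carrier_subgroup_generated)
  then have "?P \<sigma>"
  proof (induction rule: generate.induct)
    case one
    show ?case
      by (rule exI[of _ id], rule conjI, rule permutes_id) (auto simp: BijGroup_def)
  next
    case (incl h)
    with swap show ?case
      by blast
  next
    case (inv h)
    with swap inv_simple_reflection show ?case
      by force
  next
    case (eng h1 h2)
    have W: "h1 \<in> carrier (weyl_group r)" "h2 \<in> carrier (weyl_group r)"
      using eng.hyps by (simp_all add: weyl_group_def carrier_subgroup_generated)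
    obtain p1 p2 where p: "p1 permutes {1..r + 1}" "p2 permutes {1..r + 1}"
      and act: "\<And>v k. v \<in> weight_space r \<Longrightarrow> eps_coord (h1 v) k = eps_coord v (p1 k)"
        "\<And>v k. v \<in> weight_space r \<Longrightarrow> eps_coord (h2 v) k = eps_coord v (p2 k)"
      using eng.IH by blast
    have "eps_coord ((h1 \<otimes>\<^bsub>?G\<^esub> h2) v) k = eps_coord v ((p2 \<circ> p1) k)"
      if "v \<in> weight_space r" for v k
      using that mult_weyl_group_apply[OF W that] weyl_group_closed[OF W(2) that]
      by (simp add: weyl_group_def act)
    with permutes_compose[OF p(1) p(2)] show ?case
      by blast
  qed
  then show ?thesis
    using that by blast
qed

text \<open>
  If the differences of \<open>v\<close> are distinct, then the image of \<open>v\<close> determines the permutation by which a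
  group element acts, and the permutation determines the element.
\<close>

lemma weyl_group_eq_if_regular:
  assumes \<sigma>: "\<sigma> \<in> carrier (weyl_group r)" and \<tau>: "\<tau> \<in> carrier (weyl_group r)"
    and v: "v \<in> weight_space r" and regular: "inj_on (eps_coord v) {1..r + 1}"
    and eq: "\<sigma> v = \<tau> v"
  shows "\<sigma> = \<tau>"
proof -
  obtain p where p: "p permutes {1..r + 1}"
      "\<And>v k. v \<in> weight_space r \<Longrightarrow> eps_coord (\<sigma> v) k = eps_coord v (p k)"
    using weyl_group_permutes_eps_coord[OF \<sigma>] by blast
  obtain q where q: "q permutes {1..r + 1}"
      "\<And>v k. v \<in> weight_space r \<Longrightarrow> eps_coord (\<tau> v) k = eps_coord v (q k)"
    using weyl_group_permutes_eps_coord[OF \<tau>] by blast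
  have pq: "p k = q k" for k
  proof (cases "k \<in> {1..r + 1}")
    case True
    have "eps_coord v (p k) = eps_coord v (q k)"
      using p(2)[OF v, of k] q(2)[OF v, of k] eq by simp
    then show ?thesis
      using inj_onD[OF regular] True permutes_in_image[OF p(1), of k]
        permutes_in_image[OF q(1), of k] by blast
  next
    case False
    then show ?thesis
      using p(1) q(1) by (simp add: permutes_not_in)
  qed
  have same: "\<sigma> w = \<tau> w" if "w \<in> weight_space r" for w
    by (rule weight_eqI[OF weyl_group_closed[OF \<sigma> that] weyl_group_closed[OF \<tau> that]])
       (simp add: p(2) q(2) pq that)
  show ?thesis
    using Bij_imp_extensional[OF weyl_group_in_Bij[OF \<sigma>]]
      Bij_imp_extensional[OF weyl_group_in_Bij[OF \<tau>]] same
    by (rule extensionalityI)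
qed

section \<open>Products of commuting simple reflections\<close>

lemma nonconsecutive_Cons:
  "nonconsecutive (i # xs) \<longleftrightarrow>
    (\<forall>j\<in>set xs. \<bar>int i - int j\<bar> \<ge> 2) \<and> nonconsecutive xs"
  unfolding nonconsecutive_def length_Cons All_less_Suc2 nth_Cons_0 nth_Cons_Suc
    all_set_conv_all_nth
  by (simp, subst abs_minus_commute[of _ "int i"], blast)

lemma reflection_product_in_weyl_group:
  "set xs \<subseteq> {1..r} \<Longrightarrow> reflection_product r xs \<in> carrier (weyl_group r)"
proof (induction xs)
  case Nil
  show ?case
    by (simp add: reflection_product_def group.is_monoid group_weyl_group monoid.one_closed)
next
  case (Cons i xs)
  have "reflection_product r (i # xs)
      = simple_reflection r i \<otimes>\<^bsub>weyl_group r\<^esub> reflection_product r xs"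
    by (simp add: reflection_product_def)
  with Cons show ?case
    by (simp add: monoid.m_closed group.is_monoid group_weyl_group simple_reflection_in_weyl_group)
qed

text \<open>
  The assumption \<open>step\<close> says that \<open>v\<close> pairs to \<open>1\<close> with every inner simple coroot, that is,
  \<open>s\<^sub>i(v) = v - \<alpha>\<^sub>i\<close>. Subtracting simple roots orthogonal to \<open>\<alpha>\<^sub>i\<close> does not change this pairing, so
  each factor of the product subtracts its own simple root.
\<close>

lemma reflection_product_apply:
  assumes v: "v \<in> weight_space r"
    and step: "\<And>i. i \<in> {2..r - 1} \<Longrightarrow> v (i - 1) + v (i + 1) - v i = v i - 1"
  shows "set xs \<subseteq> {2..r - 1} \<Longrightarrow> nonconsecutive xs \<Longrightarrow>
    reflection_product r xs v = (\<lambda>j. v j - (if j \<in> set xs then 1 else 0))"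
proof (induction xs)
  case Nil
  then show ?case
    using one_weyl_group_apply[OF v] by (simp add: reflection_product_def)
next
  case (Cons i xs)
  let ?w = "\<lambda>j. v j - (if j \<in> set xs then 1 else 0)"
  have i: "i \<in> {2..r - 1}" "i \<in> {1..r}"
    using Cons.prems(1) by auto
  have xs: "set xs \<subseteq> {1..r}"
    using Cons.prems(1) by (force simp: subset_iff)
  have nc: "\<forall>j\<in>set xs. \<bar>int i - int j\<bar> \<ge> 2" and "nonconsecutive xs"
    using Cons.prems(2) by (auto simp: nonconsecutive_Cons)
  then have IH: "reflection_product r xs v = ?w"
    using Cons by simp
  have away: "i \<notin> set xs" "i - 1 \<notin> set xs" "i + 1 \<notin> set xs"
    using nc i by force+
  have w: "?w \<in> weight_space r"
    using IH weyl_group_closed[OF reflection_product_in_weyl_group[OF xs] v] by simp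
  have "reflection_product r (i # xs) v
      = (simple_reflection r i \<otimes>\<^bsub>weyl_group r\<^esub> reflection_product r xs) v"
    by (simp add: reflection_product_def)
  also have "\<dots> = simple_reflection r i ?w"
    unfolding mult_weyl_group_apply[OF simple_reflection_in_weyl_group[OF i(2)]
        reflection_product_in_weyl_group[OF xs] v] IH ..
  also have "\<dots> = ?w(i := ?w (i - 1) + ?w (i + 1) - ?w i)"
    by (rule simple_reflection_apply[OF w i(2)])
  also have "\<dots> = (\<lambda>j. v j - (if j \<in> set (i # xs) then 1 else 0))"
    using away step[OF i(1)] by (auto simp: fun_eq_iff)
  finally show ?case .
qed

section \<open>The image of the highest root plus the half-sum\<close>

text \<open>
  The sum of the simple roots is the highest root, so this is the regular dominant weight
  \<open>\<lambda> + \<rho>\<close>. For \<open>r \<ge> 1\<close> its differences, increased by \<open>r/2\<close>, are \<open>r + 1, r - 1, r - 2, \<dots>, 1, -1\<close>, whereas those of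
  \<open>\<rho>\<close> are \<open>r, r - 1, \<dots>, 0\<close>.
\<close>

definition root_plus_rho :: "nat \<Rightarrow> weight" where
  "root_plus_rho r = (\<Sum>i=1..r. simple_root i) + rho r"

lemma root_plus_rho_in_weight_space: "root_plus_rho r \<in> weight_space r"
  using rho_in_weight_space
  by (simp add: root_plus_rho_def weight_space_def interval_root_apply)

lemma root_plus_rho_minus_rho: "root_plus_rho r j - rho r j = (if j \<in> {1..r} then 1 else 0)"
  by (simp add: root_plus_rho_def interval_root_apply)

lemma eps_coord_rho: "k \<in> {1..r + 1} \<Longrightarrow> eps_coord (rho r) k = (real r + 2) / 2 - real k"
  by (cases k) (simp_all add: eps_coord_def rho_apply field_simps)

lemma eps_coord_root_plus_rho:
  assumes "r \<ge> 1" "k \<in> {1..r + 1}"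
  shows "eps_coord (root_plus_rho r) k =
    (real r + 2) / 2 - real k + (if k = 1 then 1 else 0) - (if k = r + 1 then 1 else 0)"
proof -
  have "eps_coord (root_plus_rho r) k = eps_coord (rho r) k
      + (if k \<in> {1..r} then 1 else 0) - (if k - 1 \<in> {1..r} then 1 else 0)"
    by (simp add: eps_coord_def root_plus_rho_def interval_root_apply)
  then show ?thesis
    using assms by (auto simp: eps_coord_rho)
qed

lemma eps_coord_root_plus_rho_less:
  assumes "r \<ge> 1" "1 \<le> i" "i < j" "j \<le> r + 1"
  shows "eps_coord (root_plus_rho r) j < eps_coord (root_plus_rho r) i"
  using assms by (simp add: eps_coord_root_plus_rho)

lemma inj_on_eps_coord_root_plus_rho:
  assumes "r \<ge> 1"
  shows "inj_on (eps_coord (root_plus_rho r)) {1..r + 1}"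
proof (rule linorder_inj_onI')
  fix i j assume "i \<in> {1..r + 1}" "j \<in> {1..r + 1}" "i < j"
  then show "eps_coord (root_plus_rho r) i \<noteq> eps_coord (root_plus_rho r) j"
    using eps_coord_root_plus_rho_less[of r i j] assms by simp
qed

text \<open>
  Compare \<open>B\<close> with \<open>{1..k}\<close> after removing their intersection: the two remainders have the same size, and
  the value \<open>f k\<close> separates the values of \<open>f\<close> on them.
\<close>

lemma sum_le_sum_initial_segment:
  fixes f :: "nat \<Rightarrow> real"
  assumes B: "B \<subseteq> {1..n}" "card B = k"
    and antimono: "\<And>i j. 1 \<le> i \<Longrightarrow> i \<le> j \<Longrightarrow> j \<le> n \<Longrightarrow> f j \<le> f i"
  shows "sum f B \<le> sum f {1..k}"
proof -
  have fin: "finite B"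
    using B(1) finite_subset by blast
  have kn: "k \<le> n"
    using card_mono[OF _ B(1)] B(2) by simp
  have card: "card (B - {1..k}) = card ({1..k} - B)"
    using fin B(2) by (simp add: card_Diff_subset_Int Int_commute)
  have "sum f (B - {1..k}) \<le> sum f ({1..k} - B)"
  proof (cases "k = 0")
    case True
    with B(2) fin show ?thesis
      by simp
  next
    case False
    have "sum f (B - {1..k}) \<le> real (card (B - {1..k})) * f k"
      by (rule sum_bounded_above) (use False B(1) in \<open>force intro: antimono\<close>)
    also have "\<dots> = real (card ({1..k} - B)) * f k"
      by (simp only: card)
    also have "\<dots> \<le> sum f ({1..k} - B)"
      by (rule sum_bounded_below) (use kn in \<open>auto intro: antimono\<close>)
    finally show ?thesis .
  qed
  then show ?thesis
    using sum.Int_Diff[OF fin, of f "{1..k}"] sum.Int_Diff[of "{1..k}" f B]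
    by (simp add: Int_commute)
qed

text \<open>
  A dominant weight is the largest one in its orbit. Here the \<open>j\<close>-th coordinate is the sum of the first \<open>j\<close>
  differences, which for the dominant weight are the \<open>j\<close> largest of all.
\<close>

lemma weyl_group_root_plus_rho_le:
  assumes "r \<ge> 1" "\<sigma> \<in> carrier (weyl_group r)"
  shows "\<sigma> (root_plus_rho r) j \<le> root_plus_rho r j"
proof (cases "j \<in> {1..r}")
  case False
  then show ?thesis
    using weyl_group_closed[OF assms(2) root_plus_rho_in_weight_space]
      root_plus_rho_in_weight_space[of r] by (auto simp: weight_space_def)
next
  case True
  let ?u = "root_plus_rho r"
  obtain p where p: "p permutes {1..r + 1}"
    and act: "\<And>v k. v \<in> weight_space r \<Longrightarrow> eps_coord (\<sigma> v) k = eps_coord v (p k)"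
    using weyl_group_permutes_eps_coord[OF assms(2)] by blast
  have zero: "?u 0 = 0" "\<sigma> ?u 0 = 0"
    using root_plus_rho_in_weight_space[of r]
      weyl_group_closed[OF assms(2) root_plus_rho_in_weight_space] by (auto simp: weight_space_def)
  have inj: "inj_on p {1..j}"
    using permutes_inj[OF p] by (rule inj_on_subset) simp
  have "\<sigma> ?u j = (\<Sum>k=1..j. eps_coord ?u (p k))"
    using sum_eps_coord[of "\<sigma> ?u" j] zero act[OF root_plus_rho_in_weight_space] by simp
  also have "\<dots> = sum (eps_coord ?u) (p ` {1..j})"
    using sum.reindex[OF inj, of "eps_coord ?u"] by simp
  also have "\<dots> \<le> sum (eps_coord ?u) {1..j}"
  proof (rule sum_le_sum_initial_segment)
    show "p ` {1..j} \<subseteq> {1..r + 1}"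
      using True permutes_image[OF p] image_mono[of "{1..j}" "{1..r + 1}" p] by force
    show "card (p ` {1..j}) = j"
      using card_image[OF inj] by simp
    show "eps_coord ?u b \<le> eps_coord ?u a" if "1 \<le> a" "a \<le> b" "b \<le> r + 1" for a b
      using eps_coord_root_plus_rho_less[OF assms(1), of a b] that by (cases "a = b") auto
  qed
  also have "\<dots> = ?u j"
    using sum_eps_coord[of ?u j] zero by simp
  finally show ?thesis .
qed

text \<open>
  Let \<open>x = \<sigma>(\<lambda> + \<rho>) - \<rho>\<close> vanish at \<open>k\<close> and \<open>k + 1\<close>, with \<open>k\<close> minimal. If \<open>k = 0\<close>, then the first difference of
  \<open>\<sigma>(\<lambda> + \<rho>)\<close> is that of \<open>\<rho>\<close>, namely \<open>r/2\<close>; but \<open>\<lambda> + \<rho>\<close> has no such difference when \<open>r \<ge> 2\<close>. If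
  \<open>k > 0\<close>, then \<open>x\<close> is \<open>1, 0, 0\<close> at \<open>k - 1, k, k + 1\<close>. The differences of \<open>\<rho>\<close> decrease by exactly \<open>1\<close>, so the drop
  of \<open>x\<close> at \<open>k\<close> makes the \<open>k\<close>-th and the \<open>(k + 1)\<close>-st difference of \<open>\<sigma>(\<lambda> + \<rho>)\<close> equal, against
  regularity.
\<close>

lemma no_adjacent_zeros:
  assumes r: "r \<ge> 2" and \<sigma>: "\<sigma> \<in> carrier (weyl_group r)"
    and x01: "\<And>j. \<sigma> (root_plus_rho r) j - rho r j \<in> {0, 1}"
  shows "k \<le> r \<Longrightarrow> \<not> (\<sigma> (root_plus_rho r) k = rho r k \<and> \<sigma> (root_plus_rho r) (k + 1) = rho r (k + 1))"
proof (induction k)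
  let ?u = "root_plus_rho r"
  obtain p where p: "p permutes {1..r + 1}"
    and act: "\<And>v k. v \<in> weight_space r \<Longrightarrow> eps_coord (\<sigma> v) k = eps_coord v (p k)"
    using weyl_group_permutes_eps_coord[OF \<sigma>] by blast
  note act = act[OF root_plus_rho_in_weight_space]
  have range: "p k \<in> {1..r + 1}" if "k \<in> {1..r + 1}" for k
    using that permutes_in_image[OF p] by blast
  {
    case 0
    show ?case
    proof
      assume "\<sigma> ?u 0 = rho r 0 \<and> \<sigma> ?u (0 + 1) = rho r (0 + 1)"
      then have "eps_coord ?u (p 1) = real r / 2"
        using act[of 1] eps_coord_rho[of 1 r] by (simp add: eps_coord_def field_simps)
      then show False
        using range[of 1] r by (auto simp: eps_coord_root_plus_rho field_simps split: if_splits)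
    qed
  next
    case (Suc k)
    show ?case
    proof
      assume zeros: "\<sigma> ?u (Suc k) = rho r (Suc k) \<and> \<sigma> ?u (Suc k + 1) = rho r (Suc k + 1)"
      with Suc have "\<sigma> ?u k \<noteq> rho r k"
        by auto
      then have "\<sigma> ?u k = rho r k + 1"
        using x01[of k] by auto
      then have "eps_coord ?u (p (Suc k)) = eps_coord (rho r) (Suc k) - 1"
        using act[of "Suc k"] zeros by (simp add: eps_coord_def)
      moreover have "eps_coord ?u (p (Suc (Suc k))) = eps_coord (rho r) (Suc (Suc k))"
        using act[of "Suc (Suc k)"] zeros by (simp add: eps_coord_def)
      ultimately have "eps_coord ?u (p (Suc k)) = eps_coord ?u (p (Suc (Suc k)))"
        using Suc.prems by (simp add: eps_coord_rho)
      then have "p (Suc k) = p (Suc (Suc k))"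
        using inj_onD[OF inj_on_eps_coord_root_plus_rho[of r]] r Suc.prems
          range[of "Suc k"] range[of "Suc (Suc k)"] by simp
      then show False
        using injD[OF permutes_inj[OF p], of "Suc k" "Suc (Suc k)"] by simp
    qed
  }
qed

lemma weyl_alternation_set_iff:
  "\<sigma> \<in> weyl_alternation_set r (\<Sum>i=1..r. simple_root i) 0 \<longleftrightarrow>
    \<sigma> \<in> carrier (weyl_group r) \<and> (\<forall>j. \<sigma> (root_plus_rho r) j - rho r j \<in> \<nat>)"
proof (cases "\<sigma> \<in> carrier (weyl_group r)")
  case True
  have "\<sigma> (root_plus_rho r) - rho r \<in> weight_space r"
    using weyl_group_closed[OF True root_plus_rho_in_weight_space] rho_in_weight_space[of r]
    by (auto simp: weight_space_def)
  from kostant_partition_pos_iff[OF this] True show ?thesis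
    by (simp add: weyl_alternation_set_def root_plus_rho_def)
qed (simp add: weyl_alternation_set_def)

lemma nonconsecutive_sorted_list_of_set:
  assumes "finite I" "\<And>i. i \<in> I \<Longrightarrow> i + 1 \<notin> I"
  shows "nonconsecutive (sorted_list_of_set I)"
  unfolding nonconsecutive_def
proof (intro allI impI)
  let ?xs = "sorted_list_of_set I"
  fix a b assume ab: "a < length ?xs" "b < length ?xs" "a \<noteq> b"
  have "?xs ! a \<in> I" "?xs ! b \<in> I"
    using ab nth_mem assms(1) by (metis set_sorted_list_of_set)+
  then have "?xs ! a + 1 \<noteq> ?xs ! b" "?xs ! b + 1 \<noteq> ?xs ! a"
    using assms(2) by metis+
  moreover have "?xs ! a \<noteq> ?xs ! b"
    using ab by (simp add: nth_eq_iff_index_eq)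
  ultimately show "\<bar>int (?xs ! a) - int (?xs ! b)\<bar> \<ge> 2"
    by linarith
qed

theorem theorem1p1:
  fixes r :: nat and lam :: weight and \<sigma> :: "weight \<Rightarrow> weight"
  assumes "r \<ge> 2"
    and "lam = (\<Sum>i=1..r. simple_root i)"
  shows "\<sigma> \<in> weyl_alternation_set r lam 0 \<longleftrightarrow>
    \<sigma> = \<one>\<^bsub>weyl_group r\<^esub> \<or>
    (\<exists>is. is \<noteq> [] \<and> set is \<subseteq> {2..r - 1} \<and> nonconsecutive is \<and> \<sigma> = reflection_product r is)"
proof -
  let ?u = "root_plus_rho r"
  have product: "reflection_product r js ?u = (\<lambda>j. ?u j - (if j \<in> set js then 1 else 0))"
    if "set js \<subseteq> {2..r - 1}" "nonconsecutive js" for js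
  proof (rule reflection_product_apply[OF root_plus_rho_in_weight_space _ that])
    fix i assume i: "i \<in> {2..r - 1}"
    have formula: "?u j = 1 + real j * (real r + 1 - real j) / 2" if "j \<in> {1..r}" for j
      using root_plus_rho_minus_rho[of r j] rho_apply[of j r] that by auto
    have inner: "i - 1 \<in> {1..r}" "i \<in> {1..r}" "i + 1 \<in> {1..r}"
      using i by auto
    have "?u (i - 1) = 1 + (real i - 1) * (real r + 2 - real i) / 2"
      using formula[OF inner(1)] i by (simp add: of_nat_diff field_simps)
    moreover have "?u i = 1 + real i * (real r + 1 - real i) / 2"
      using formula[OF inner(2)] .
    moreover have "?u (i + 1) = 1 + (real i + 1) * (real r - real i) / 2"
      using formula[OF inner(3)] by (simp add: field_simps)
    ultimately show "?u (i - 1) + ?u (i + 1) - ?u i = ?u i - 1"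
      by (simp add: field_simps)
  qed
  \<comment> \<open>The identity is the product of the empty list, so both alternatives are treated together.\<close>
  have "\<sigma> \<in> weyl_alternation_set r lam 0 \<longleftrightarrow>
    (\<exists>js. set js \<subseteq> {2..r - 1} \<and> nonconsecutive js \<and> \<sigma> = reflection_product r js)"
    unfolding assms(2) weyl_alternation_set_iff
  proof
    assume A: "\<sigma> \<in> carrier (weyl_group r) \<and> (\<forall>j. \<sigma> ?u j - rho r j \<in> \<nat>)"
    then have \<sigma>: "\<sigma> \<in> carrier (weyl_group r)"
      by simp
    have x01: "\<sigma> ?u j - rho r j \<in> {0, 1}" for j
    proof -
      obtain n where n: "\<sigma> ?u j - rho r j = real n"
        using A Nats_cases by metis
      moreover have "\<sigma> ?u j - rho r j \<le> 1"
        using weyl_group_root_plus_rho_le[OF _ \<sigma>, of j] root_plus_rho_minus_rho[of r j] assms(1)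
        by (auto split: if_splits)
      ultimately have "n \<le> 1"
        by simp
      with n show ?thesis
        by (auto simp: le_Suc_eq)
    qed
    note gap = no_adjacent_zeros[OF assms(1) \<sigma> x01]
    have outside: "\<sigma> ?u j = rho r j" "?u j = rho r j" if "j \<notin> {1..r}" for j
      using weyl_group_closed[OF \<sigma> root_plus_rho_in_weight_space] rho_in_weight_space[of r]
        root_plus_rho_in_weight_space[of r] that by (auto simp: weight_space_def)
    \<comment> \<open>The zeros of \<open>x\<close> are the places where \<open>\<lambda>\<close> has lost a simple root.\<close>
    define I where "I = {j \<in> {1..r}. \<sigma> ?u j = rho r j}"
    have fin: "finite I"
      by (simp add: I_def)
    have "1 \<notin> I"
      using gap[of 0] outside(1)[of 0] by (auto simp: I_def)
    moreover have "r \<notin> I"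
      using gap[of r] outside(1)[of "r + 1"] by (auto simp: I_def)
    moreover have "I \<subseteq> {1..r}"
      by (auto simp: I_def)
    moreover have "j \<in> {2..r - 1}" if "j \<in> {1..r}" "j \<noteq> 1" "j \<noteq> r" for j
      using that by auto
    ultimately have I: "set (sorted_list_of_set I) \<subseteq> {2..r - 1}"
      using fin by (metis set_sorted_list_of_set subsetD subsetI)
    have nc: "nonconsecutive (sorted_list_of_set I)"
      by (rule nonconsecutive_sorted_list_of_set[OF fin]) (use gap in \<open>auto simp: I_def\<close>)
    have \<tau>: "reflection_product r (sorted_list_of_set I) ?u = (\<lambda>j. ?u j - (if j \<in> I then 1 else 0))"
      using product[OF I nc] fin by simp
    have "\<sigma> ?u = reflection_product r (sorted_list_of_set I) ?u"
      unfolding \<tau>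
    proof
      fix j
      show "\<sigma> ?u j = ?u j - (if j \<in> I then 1 else 0)"
        using x01[of j] outside[of j] root_plus_rho_minus_rho[of r j]
        by (cases "j \<in> {1..r}") (auto simp: I_def)
    qed
    moreover have "set (sorted_list_of_set I) \<subseteq> {1..r}"
      using I by (force simp: subset_iff)
    ultimately have "\<sigma> = reflection_product r (sorted_list_of_set I)"
      using weyl_group_eq_if_regular[OF \<sigma> reflection_product_in_weyl_group
          root_plus_rho_in_weight_space inj_on_eps_coord_root_plus_rho] assms(1) by simp
    with I nc show "\<exists>js. set js \<subseteq> {2..r - 1} \<and> nonconsecutive js \<and> \<sigma> = reflection_product r js"
      by blast
  next
    assume "\<exists>js. set js \<subseteq> {2..r - 1} \<and> nonconsecutive js \<and> \<sigma> = reflection_product r js"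
    then obtain js where js: "set js \<subseteq> {2..r - 1}" "nonconsecutive js"
      and \<sigma>: "\<sigma> = reflection_product r js"
      by blast
    have "set js \<subseteq> {1..r}"
      using js(1) by (force simp: subset_iff)
    then have "\<sigma> \<in> carrier (weyl_group r)"
      by (simp add: \<sigma> reflection_product_in_weyl_group)
    moreover have "\<sigma> ?u j - rho r j \<in> \<nat>" for j
    proof -
      have "\<sigma> ?u j - rho r j = (if j \<in> {1..r} - set js then 1 else 0)"
        using root_plus_rho_minus_rho[of r j] \<open>set js \<subseteq> {1..r}\<close>
        by (auto simp: \<sigma> product[OF js] subset_iff)
      then show ?thesis
        by simp
    qed
    ultimately show "\<sigma> \<in> carrier (weyl_group r) \<and> (\<forall>j. \<sigma> ?u j - rho r j \<in> \<nat>)"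
      by blast
  qed
  also have "\<dots> \<longleftrightarrow> \<sigma> = \<one>\<^bsub>weyl_group r\<^esub> \<or>
    (\<exists>is. is \<noteq> [] \<and> set is \<subseteq> {2..r - 1} \<and> nonconsecutive is \<and> \<sigma> = reflection_product r is)"
  proof -
    have "reflection_product r [] = \<one>\<^bsub>weyl_group r\<^esub>" "nonconsecutive []"
      by (simp_all add: reflection_product_def nonconsecutive_def)
    then show ?thesis
      by (metis empty_set empty_subsetI)
  qed
  finally show ?thesis .
qed

end
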